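(* Let $n,r\ge 1$, let $X\in\mathbb{R}^{n\times n}$ be symmetric, let $E\subseteq [n]\times[n]$ be symmetric (i.e. $(i,j)\in E$ implies $(j,i)\in E$), and let $U_0\in\mathbb{R}^{n\times r}$ with $U_0\ge 0$. Choose $$\lambda>\tfrac12\Bigl(\|\mathcal{P}_E(X)\|_2+\|\mathcal{P}_E(X-U_0U_0^T)\|_F-\sigma_n(\mathcal{P}_E(X))\Bigr),$$ and consider the regularized problem $$\min_{U,V\in\mathbb{R}^{n\times r}} f(U,V)=\tfrac12\|\mathcal{P}_E(X-UV^T)\|_F^2+\tfrac{\lambda}{2}\|U-V\|_F^2\quad\text{s.t. } U\ge 0,\ V\ge 0, \tag{A}$$ and the symmetric problem $$\min_{U\in\mathbb{R}^{n\times r}} \tfrac12\|\mathcal{P}_E(X-UU^T)\|_F^2\quad\text{s.t. } U\ge 0. \tag{S}$$ Let $\{(U_k,V_k)\}_{k\ge 0}$ be any sequence of feasible points of (A) (the iterates of a local search algorithm) with initialization $V_0=U_0$, such that the objective is sequentially decreasing, i.e. $f(U_{k+1},V_{k+1})\le f(U_k,V_k)$ for all $k\ge 0$, and such that $(U_k,V_k)$ converges to a critical point $(U^*,V^* )$ of (A). Then $U^*=V^*$, and $U^*$ is a critical point of (S).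
   Context: For $E\subseteq[n]\times[n]$, the masking operator $\mathcal{P}_E:\mathbb{R}^{n\times n}\to\mathbb{R}^{n\times n}$ is defined by $[\mathcal{P}_E(Y)]_{ij}=Y_{ij}$ if $(i,j)\in E$ and $0$ otherwise. $U\ge 0$ means entrywise nonnegative; $\|\cdot\|_F$ is the Frobenius norm; $\|\cdot\|_2$ is the largest singular value; $\sigma_n(A)$ denotes the $n$-th largest (i.e. smallest) eigenvalue of a symmetric matrix $A\in\mathbb{R}^{n\times n}$. For $U\ge 0$ let $\partial\delta_+(U)=\{G\in\mathbb{R}^{n\times r}: G\circ U=0,\ G\le 0\}$ ($\circ$ is the entrywise product), and $\partial\delta_+(U)=\emptyset$ if $U\not\ge 0$. A pair $(U,V)$ is a critical point of (A) if $0\in \mathcal{P}_E(UV^T-X)V+\lambda(U-V)+\partial\delta_+(U)$ and $0\in \mathcal{P}_E(UV^T-X)^TU-\lambda(U-V)+\partial\delta_+(V)$. A matrix $U$ is a critical point of (S) if $0\in\mathcal{P}_E(UU^T-X)U+\partial\delta_+(U)$. *)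

theory Defs
  imports "HOL-Analysis.Analysis"
begin

text \<open>
  A real matrix with rows indexed by \<open>'m\<close> and columns indexed by \<open>'n\<close> has type
  \<open>real ^ 'n ^ 'm\<close>. On this type the library's \<open>\<le>\<close> is the entrywise order and \<open>*\<close> is the
  entrywise (Hadamard) product; the matrix product is \<open>**\<close>.
\<close>

definition mask :: "('m \<times> 'n) set \<Rightarrow> real ^ 'n ^ 'm \<Rightarrow> real ^ 'n ^ 'm" where
  "mask E Y = (\<chi> i j. if (i, j) \<in> E then Y $ i $ j else 0)"

definition frobenius_norm :: "real ^ 'n ^ 'm \<Rightarrow> real" where
  "frobenius_norm A = sqrt (\<Sum>i\<in>UNIV. \<Sum>j\<in>UNIV. (A $ i $ j)\<^sup>2)"

definition eigenvalues :: "real ^ 'n ^ 'n \<Rightarrow> real set" where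
  "eigenvalues A = {c. \<exists>v. v \<noteq> 0 \<and> A *v v = c *\<^sub>R v}"

text \<open>
  Meant for symmetric \<open>A\<close>, for which the set of real eigenvalues is finite and nonempty.
  The \<open>n\<close>-th largest of the \<open>n\<close> eigenvalues counted with multiplicity is the smallest one.
\<close>
definition min_eigenvalue :: "real ^ 'n ^ 'n \<Rightarrow> real" where
  "min_eigenvalue A = Min (eigenvalues A)"

definition singular_values :: "real ^ 'n ^ 'n \<Rightarrow> real set" where
  "singular_values A = sqrt ` eigenvalues (transpose A ** A)"

definition spectral_norm :: "real ^ 'n ^ 'n \<Rightarrow> real" where
  "spectral_norm A = Max (singular_values A)"

definition subdiff_nonneg :: "real ^ 'r ^ 'n \<Rightarrow> (real ^ 'r ^ 'n) set" where
  "subdiff_nonneg U = (if 0 \<le> U then {G. G * U = 0 \<and> G \<le> 0} else {})"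

lemma subdiff_nonneg_iff:
  "G \<in> subdiff_nonneg U \<longleftrightarrow>
    (\<forall>i j. 0 \<le> U $ i $ j) \<and> (\<forall>i j. G $ i $ j * U $ i $ j = 0) \<and> (\<forall>i j. G $ i $ j \<le> 0)"
  by (auto simp: subdiff_nonneg_def less_eq_vec_def vec_eq_iff)

definition objective_A ::
    "('n \<times> 'n) set \<Rightarrow> real ^ 'n ^ 'n \<Rightarrow> real \<Rightarrow> real ^ 'r ^ 'n \<Rightarrow> real ^ 'r ^ 'n \<Rightarrow> real" where
  "objective_A E X lam U V =
    1/2 * (frobenius_norm (mask E (X - U ** transpose V)))\<^sup>2 + lam/2 * (frobenius_norm (U - V))\<^sup>2"

definition feasible_A :: "real ^ 'r ^ 'n \<Rightarrow> real ^ 'r ^ 'n \<Rightarrow> bool" where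
  "feasible_A U V \<longleftrightarrow> 0 \<le> U \<and> 0 \<le> V"

text \<open>
  The sum of a matrix \<open>M\<close> and a set \<open>S\<close> of matrices is written as the image \<open>(+) M ` S\<close>.
  Critical points are feasible, since \<open>subdiff_nonneg\<close> is empty at infeasible points.
\<close>
definition critical_point_A ::
    "('n \<times> 'n) set \<Rightarrow> real ^ 'n ^ 'n \<Rightarrow> real \<Rightarrow> real ^ 'r ^ 'n \<Rightarrow> real ^ 'r ^ 'n \<Rightarrow> bool" where
  "critical_point_A E X lam U V \<longleftrightarrow>
    0 \<in> (+) (mask E (U ** transpose V - X) ** V + lam *\<^sub>R (U - V)) ` subdiff_nonneg U \<and>
    0 \<in> (+) (transpose (mask E (U ** transpose V - X)) ** U - lam *\<^sub>R (U - V)) ` subdiff_nonneg V"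

definition critical_point_S ::
    "('n \<times> 'n) set \<Rightarrow> real ^ 'n ^ 'n \<Rightarrow> real ^ 'r ^ 'n \<Rightarrow> bool" where
  "critical_point_S E X U \<longleftrightarrow>
    0 \<in> (+) (mask E (U ** transpose U - X) ** U) ` subdiff_nonneg U"

end

theory Submission
  imports Defs
begin

text \<open>
  At a critical point \<open>(U, V)\<close> of (A), put \<open>W = P\<^sub>E(U V\<^sup>T - X)\<close> and \<open>D = U - V\<close>. Subtracting the two
  inclusions and pairing with \<open>D\<close>, where complementarity gives the subgradients a favourable sign,
  yields \<open>\<langle>W V - W\<^sup>T U, D\<rangle> + 2 \<lambda> \<parallel>D\<parallel>\<^sup>2 \<le> 0\<close>. The first term equals
  \<open>\<langle>W, Z\<rangle> - \<langle>W D, D\<rangle>\<close> with \<open>Z = U V\<^sup>T - V U\<^sup>T\<close> antisymmetric, and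
  \<open>2 \<langle>W, Z\<rangle> = \<langle>W - W\<^sup>T, Z\<rangle> = \<langle>P\<^sub>E Z, Z\<rangle> \<ge> 0\<close>. So \<open>(2 \<lambda> - \<parallel>W\<parallel>\<^sub>F) \<parallel>D\<parallel>\<^sup>2 \<le> 0\<close>, while descent from
  \<open>(U\<^sub>0, U\<^sub>0)\<close> gives \<open>\<parallel>W\<parallel>\<^sub>F \<le> \<parallel>P\<^sub>E(X - U\<^sub>0 U\<^sub>0\<^sup>T)\<parallel>\<^sub>F < 2 \<lambda>\<close>.
  The strict bound holds because \<open>\<sigma>\<^sub>n(P\<^sub>E(X)) \<le> \<parallel>P\<^sub>E(X)\<parallel>\<^sub>2\<close>.
\<close>

section \<open>Eigenvalues of symmetric matrices\<close>

lemma inner_symmetric_matrix: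
  fixes A :: "real ^ 'n ^ 'n"
  assumes "transpose A = A"
  shows "(A *v x) \<bullet> y = x \<bullet> (A *v y)"
  by (metis assms dot_lmul_matrix matrix_transpose_mul vector_transpose_matrix)

lemma symmetric_eigenvectors_orthogonal:
  fixes A :: "real ^ 'n ^ 'n"
  assumes "transpose A = A" "A *v v = c *\<^sub>R v" "A *v w = d *\<^sub>R w" "c \<noteq> d"
  shows "v \<bullet> w = 0"
  using inner_symmetric_matrix[OF assms(1), of v w] assms(2-4) by simp

text \<open>One chosen eigenvector per eigenvalue gives an orthogonal family of nonzero vectors,
  which is independent and hence finite. Finiteness is what gives \<open>Min\<close> and
  \<open>Max\<close> over spectra their intended meaning.\<close>

lemma finite_eigenvalues_symmetric:
  fixes A :: "real ^ 'n ^ 'n"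
  assumes "transpose A = A"
  shows "finite (eigenvalues A)"
proof -
  define v where "v c = (SOME v. v \<noteq> 0 \<and> A *v v = c *\<^sub>R v)" for c
  have v: "v c \<noteq> 0" "A *v v c = c *\<^sub>R v c" if "c \<in> eigenvalues A" for c
    using someI_ex[of "\<lambda>v. v \<noteq> 0 \<and> A *v v = c *\<^sub>R v"] that
    unfolding v_def eigenvalues_def by blast+
  have orth: "v c \<bullet> v d = 0" if "c \<in> eigenvalues A" "d \<in> eigenvalues A" "c \<noteq> d" for c d
    using symmetric_eigenvectors_orthogonal[OF assms v(2) v(2)] that by blast
  have "inj_on v (eigenvalues A)"
    using orth v(1) by (metis inj_onI inner_eq_zero_iff)
  moreover have "finite (v ` eigenvalues A)"
  proof (rule finiteI_independent[OF pairwise_orthogonal_independent])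
    show "pairwise orthogonal (v ` eigenvalues A)"
      using orth by (auto simp: pairwise_def orthogonal_def)
  qed (use v(1) in auto)
  ultimately show ?thesis
    by (simp add: finite_image_iff)
qed

text \<open>A maximizer of the quadratic form on the compact unit sphere is an eigenvector, with the
  maximum as its eigenvalue.\<close>

lemma eigenvalues_symmetric_nonempty:
  fixes A :: "real ^ 'n ^ 'n"
  assumes sym: "transpose A = A"
  shows "eigenvalues A \<noteq> {}"
proof -
  have "\<exists>v\<in>sphere 0 1. \<forall>w\<in>sphere 0 1. w \<bullet> (A *v w) \<le> v \<bullet> (A *v v)"
    by (intro continuous_attains_sup compact_sphere continuous_on_inner continuous_on_id
        matrix_vector_mult_linear_continuous_on) (simp add: sphere_eq_empty)
  then obtain v where v: "norm v = 1" and max: "\<And>w. norm w = 1 \<Longrightarrow> w \<bullet> (A *v w) \<le> v \<bullet> (A *v v)"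
    by auto
  define m where "m = v \<bullet> (A *v v)"
  have bound: "w \<bullet> (A *v w) \<le> m * (w \<bullet> w)" for w
  proof (cases "w = 0")
    case False
    have "(w /\<^sub>R norm w) \<bullet> (A *v (w /\<^sub>R norm w)) \<le> m"
      unfolding m_def using False by (intro max) simp
    with False show ?thesis
      by (simp add: matrix_vector_mult_scaleR field_simps dot_square_norm power2_eq_square)
  qed simp
  \<comment> \<open>The residual of the eigenvalue equation at \<open>v\<close>; the goal is now
    \<open>u = 0\<close>.\<close>
  define u where "u = m *\<^sub>R v - A *v v"
  define q where "q = m * (u \<bullet> u) - u \<bullet> (A *v u)"
  have "v \<bullet> v = 1"
    using v by (simp add: dot_square_norm)
  \<comment> \<open>The form \<open>w \<mapsto> m \<parallel>w\<parallel>\<^sup>2 - \<langle>w, A w\<rangle>\<close> is nonnegative and vanishes at \<open>v\<close>; evaluate it at \<open>v - t u\<close>.\<close>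
  have quad: "2 * t * (u \<bullet> u) \<le> t\<^sup>2 * q" for t
  proof -
    have form: "(v - t *\<^sub>R u) \<bullet> (A *v (v - t *\<^sub>R u))
        = m - 2 * t * (u \<bullet> (A *v v)) + t\<^sup>2 * (u \<bullet> (A *v u))"
      using inner_symmetric_matrix[OF sym, of v u]
      by (simp add: m_def matrix_vector_mult_diff_distrib matrix_vector_mult_scaleR
          inner_diff inner_commute[of _ u] power2_eq_square algebra_simps)
    have sq: "m * ((v - t *\<^sub>R u) \<bullet> (v - t *\<^sub>R u))
        = m - 2 * t * (m * (u \<bullet> v)) + t\<^sup>2 * (m * (u \<bullet> u))"
      using \<open>v \<bullet> v = 1\<close>
      by (simp add: inner_diff inner_commute[of v u] power2_eq_square algebra_simps)
    \<comment> \<open>Unfolding only the right factor identifies the coefficient of the linear term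
      in \<open>t\<close>.\<close>
    have "u \<bullet> u = m * (u \<bullet> v) - u \<bullet> (A *v v)"
      by (subst (2) u_def) (simp add: inner_diff_right)
    then have "2 * t * (u \<bullet> u) = 2 * t * (m * (u \<bullet> v)) - 2 * t * (u \<bullet> (A *v v))"
      by (simp add: right_diff_distrib)
    with bound[of "v - t *\<^sub>R u"] show ?thesis
      unfolding form sq q_def right_diff_distrib by linarith
  qed
  have "u \<bullet> u \<le> 0"
  proof (rule ccontr)
    assume "\<not> u \<bullet> u \<le> 0"
    then have "u \<bullet> u > 0"
      by linarith
    moreover from this have "q > 0"
      using quad[of 1] by (simp del: inner_gt_zero_iff)
    \<comment> \<open>For this \<open>t\<close> the quadratic term is only half the linear one, so a
      positive number would be at least its double.\<close>
    moreover have "2 * (u \<bullet> u / q) * (u \<bullet> u) \<le> (u \<bullet> u / q) * (u \<bullet> u)"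
      using quad[of "u \<bullet> u / q"] \<open>q > 0\<close> by (simp add: power2_eq_square)
    moreover have "(u \<bullet> u / q) * (u \<bullet> u) > 0"
      using \<open>u \<bullet> u > 0\<close> \<open>q > 0\<close> by simp
    ultimately show False
      by linarith
  qed
  then have "u = 0"
    by (metis inner_ge_zero inner_eq_zero_iff order_antisym)
  then have "A *v v = m *\<^sub>R v"
    by (simp add: u_def)
  moreover have "v \<noteq> 0"
    using v by auto
  ultimately show ?thesis
    unfolding eigenvalues_def by blast
qed

text \<open>The square of an eigenvalue \<open>c\<close> of a symmetric \<open>A\<close> is an
  eigenvalue of \<open>transpose A ** A\<close>, so the absolute value of \<open>c\<close> is a
  singular value.\<close>

lemma min_eigenvalue_le_spectral_norm:
  fixes A :: "real ^ 'n ^ 'n"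
  assumes sym: "transpose A = A"
  shows "min_eigenvalue A \<le> spectral_norm A"
proof -
  let ?c = "min_eigenvalue A"
  have "?c \<in> eigenvalues A"
    unfolding min_eigenvalue_def
    by (intro Min_in finite_eigenvalues_symmetric eigenvalues_symmetric_nonempty sym)
  then obtain v where "v \<noteq> 0" "A *v v = ?c *\<^sub>R v"
    unfolding eigenvalues_def by blast
  then have "(transpose A ** A) *v v = (?c\<^sup>2) *\<^sub>R v"
    by (simp add: sym matrix_vector_mul_assoc[symmetric] matrix_vector_mult_scaleR power2_eq_square)
  with \<open>v \<noteq> 0\<close> have "?c\<^sup>2 \<in> eigenvalues (transpose A ** A)"
    unfolding eigenvalues_def by blast
  then have "\<bar>?c\<bar> \<in> singular_values A"
    unfolding singular_values_def by (metis image_eqI real_sqrt_abs)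
  moreover have "finite (singular_values A)"
    unfolding singular_values_def
    by (intro finite_imageI finite_eigenvalues_symmetric) (simp add: matrix_transpose_mul)
  ultimately have "\<bar>?c\<bar> \<le> spectral_norm A"
    unfolding spectral_norm_def by simp
  then show ?thesis
    by simp
qed

section \<open>The Frobenius inner product and the mask\<close>

lemma inner_matrix_eq_sum: "(A :: real ^ 'n ^ 'm) \<bullet> B = (\<Sum>i\<in>UNIV. \<Sum>j\<in>UNIV. A $ i $ j * B $ i $ j)"
  by (simp add: inner_vec_def)

lemma frobenius_norm_eq_norm: "frobenius_norm A = norm A"
  by (simp add: frobenius_norm_def norm_eq_sqrt_inner inner_matrix_eq_sum power2_eq_square)

lemma inner_transpose: "transpose A \<bullet> transpose B = A \<bullet> (B :: real ^ 'n ^ 'm)"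
  unfolding inner_matrix_eq_sum transpose_def by (simp, rule sum.swap)

lemma inner_matrix_mult_left:
  fixes A :: "real ^ 'k ^ 'm" and B :: "real ^ 'n ^ 'k"
  shows "(A ** B) \<bullet> C = A \<bullet> (C ** transpose B)"
proof -
  have "(A ** B) \<bullet> C = (\<Sum>i\<in>UNIV. \<Sum>j\<in>UNIV. \<Sum>k\<in>UNIV. A $ i $ k * B $ k $ j * C $ i $ j)"
    by (simp add: inner_matrix_eq_sum matrix_matrix_mult_def sum_distrib_right)
  also have "\<dots> = (\<Sum>i\<in>UNIV. \<Sum>k\<in>UNIV. \<Sum>j\<in>UNIV. A $ i $ k * B $ k $ j * C $ i $ j)"
    by (intro sum.cong refl sum.swap)
  also have "\<dots> = A \<bullet> (C ** transpose B)"
    by (simp add: inner_matrix_eq_sum matrix_matrix_mult_def transpose_def sum_distrib_left mult_ac)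
  finally show ?thesis .
qed

lemma inner_transpose_matrix_mult_left:
  fixes A :: "real ^ 'k ^ 'm" and B :: "real ^ 'n ^ 'm"
  shows "(transpose A ** B) \<bullet> C = (A ** C) \<bullet> B"
proof -
  have "(transpose A ** B) \<bullet> C = transpose A \<bullet> transpose (B ** transpose C)"
    by (simp add: inner_matrix_mult_left matrix_transpose_mul)
  then show ?thesis
    by (simp add: inner_transpose inner_matrix_mult_left)
qed

lemma matrix_mult_diff_right: "A ** (B - C) = A ** B - A ** (C :: real ^ 'n ^ 'k)"
  by (simp add: vec_eq_iff matrix_matrix_mult_def right_diff_distrib sum_subtractf)

text \<open>The entries are inner products of rows of \<open>D\<close>; Cauchy-Schwarz on each pair
  of rows leaves a double sum that factors.\<close>

lemma norm_gram_le:
  fixes D :: "real ^ 'r ^ 'n"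
  shows "norm (D ** transpose D) \<le> (norm D)\<^sup>2"
proof (rule power2_le_imp_le)
  have "(norm (D ** transpose D))\<^sup>2 = (\<Sum>i\<in>UNIV. \<Sum>j\<in>UNIV. (D $ i \<bullet> D $ j)\<^sup>2)"
    unfolding power2_norm_eq_inner inner_matrix_eq_sum
    by (simp add: matrix_matrix_mult_def transpose_def power2_eq_square inner_vec_def)
  also have "\<dots> \<le> (\<Sum>i\<in>UNIV. \<Sum>j\<in>UNIV. (D $ i \<bullet> D $ i) * (D $ j \<bullet> D $ j))"
    by (intro sum_mono Cauchy_Schwarz_ineq)
  also have "\<dots> = (D \<bullet> D)\<^sup>2"
    unfolding inner_vec_def[of D D] power2_eq_square sum_product ..
  finally show "(norm (D ** transpose D))\<^sup>2 \<le> ((norm D)\<^sup>2)\<^sup>2"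
    by (simp add: power2_norm_eq_inner)
qed simp

lemma inner_matrix_mult_le:
  fixes W :: "real ^ 'n ^ 'n" and D :: "real ^ 'r ^ 'n"
  shows "(W ** D) \<bullet> D \<le> norm W * (norm D)\<^sup>2"
proof -
  have "(W ** D) \<bullet> D \<le> norm W * norm (D ** transpose D)"
    by (simp add: inner_matrix_mult_left norm_cauchy_schwarz)
  also have "\<dots> \<le> norm W * (norm D)\<^sup>2"
    by (intro mult_left_mono norm_gram_le) simp
  finally show ?thesis .
qed

lemma mask_diff: "mask E (A - B) = mask E A - mask E B"
  by (simp add: mask_def vec_eq_iff)

lemma transpose_mask: "sym E \<Longrightarrow> transpose (mask E A) = mask E (transpose A)"
  by (auto simp: mask_def transpose_def vec_eq_iff dest: symD)

lemma inner_mask_nonneg: "0 \<le> mask E A \<bullet> A"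
  by (auto simp: inner_matrix_eq_sum mask_def intro!: sum_nonneg)

lemma tendsto_mask:
  "(f \<longlongrightarrow> A) F \<Longrightarrow> ((\<lambda>x. mask E (f x)) \<longlongrightarrow> mask E A) F"
  unfolding mask_def by (intro tendsto_vec_lambda) (simp add: tendsto_vec_nth)

lemma tendsto_matrix_mult_transpose:
  fixes f :: "'a \<Rightarrow> real ^ 'k ^ 'm" and g :: "'a \<Rightarrow> real ^ 'k ^ 'n"
  shows "(f \<longlongrightarrow> A) F \<Longrightarrow> (g \<longlongrightarrow> B) F \<Longrightarrow>
    ((\<lambda>x. f x ** transpose (g x)) \<longlongrightarrow> A ** transpose B) F"
  unfolding matrix_matrix_mult_def transpose_def
  by (intro tendsto_vec_lambda tendsto_sum) (simp add: tendsto_mult tendsto_vec_nth)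

lemma tendsto_objective_A:
  "(f \<longlongrightarrow> A) F \<Longrightarrow> (g \<longlongrightarrow> B) F \<Longrightarrow>
    ((\<lambda>x. objective_A E X lam (f x) (g x)) \<longlongrightarrow> objective_A E X lam A B) F"
  unfolding objective_A_def frobenius_norm_eq_norm
  by (intro tendsto_intros tendsto_mask tendsto_matrix_mult_transpose)

section \<open>Critical points\<close>

text \<open>Complementarity kills the pairing with \<open>U\<close>, and opposite signs make the
  pairing with \<open>V\<close> nonpositive.\<close>

lemma subdiff_nonneg_inner_diff:
  assumes "G \<in> subdiff_nonneg U" "0 \<le> V"
  shows "0 \<le> G \<bullet> (U - V)"
proof -
  have "G \<bullet> U = 0"
    using assms(1) unfolding subdiff_nonneg_iff inner_matrix_eq_sum by (auto intro!: sum.neutral)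
  moreover have "G \<bullet> V \<le> 0"
    using assms
    by (auto simp: subdiff_nonneg_iff inner_matrix_eq_sum less_eq_vec_def mult_nonpos_nonneg
        intro!: sum_nonpos)
  ultimately show ?thesis
    by (simp add: inner_diff_right)
qed

lemma zero_in_translate: "(0 :: 'a :: group_add) \<in> (+) M ` S \<longleftrightarrow> (\<exists>G\<in>S. M + G = 0)"
  by (metis image_iff)

lemma inner_residual_diff_ge:
  fixes X :: "real ^ 'n ^ 'n" and U V :: "real ^ 'r ^ 'n"
  assumes sym: "transpose X = X" "sym E"
  defines "W \<equiv> mask E (U ** transpose V - X)"
  shows "- ((W ** (U - V)) \<bullet> (U - V)) \<le> (W ** V - transpose W ** U) \<bullet> (U - V)"
proof -
  define Z where "Z = U ** transpose V - V ** transpose U"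
  have "transpose Z = - Z"
    by (simp add: Z_def vec_eq_iff transpose_def matrix_matrix_mult_def mult.commute)
  have "transpose (U ** transpose V - X) = V ** transpose U - X"
    using sym(1) by (simp add: vec_eq_iff transpose_def matrix_matrix_mult_def mult.commute)
  then have "W - transpose W = mask E Z"
    unfolding W_def transpose_mask[OF sym(2)] Z_def by (simp flip: mask_diff)
  then have "0 \<le> (W - transpose W) \<bullet> Z"
    by (simp add: inner_mask_nonneg)
  also have "\<dots> = 2 * (W \<bullet> Z)"
    using inner_transpose[of W Z] \<open>transpose Z = - Z\<close> by (simp add: inner_diff_left)
  finally have "0 \<le> (W ** V) \<bullet> U - (W ** U) \<bullet> V"
    by (simp add: Z_def inner_diff_right inner_matrix_mult_left)
  \<comment> \<open>The terms pairing \<open>W ** U\<close> with \<open>U\<close> and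
    \<open>W ** V\<close> with \<open>V\<close> cancel in this sum.\<close>
  also have "\<dots> = (W ** V - transpose W ** U) \<bullet> (U - V) + (W ** (U - V)) \<bullet> (U - V)"
    by (simp add: inner_diff matrix_mult_diff_right inner_transpose_matrix_mult_left)
  finally show ?thesis
    by simp
qed

lemma critical_point_A_eq:
  fixes X :: "real ^ 'n ^ 'n" and U V :: "real ^ 'r ^ 'n"
  assumes sym: "transpose X = X" "sym E"
    and crit: "critical_point_A E X lam U V"
    and lam: "norm (mask E (X - U ** transpose V)) < 2 * lam"
  shows "U = V"
proof (rule ccontr)
  assume "U \<noteq> V"
  define W where "W = mask E (U ** transpose V - X)"
  from crit obtain G H where GH: "G \<in> subdiff_nonneg U" "H \<in> subdiff_nonneg V"
    and eqs: "W ** V + lam *\<^sub>R (U - V) + G = 0" "transpose W ** U - lam *\<^sub>R (U - V) + H = 0"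
    unfolding critical_point_A_def zero_in_translate W_def by blast
  have "0 \<le> U" "0 \<le> V"
    using GH by (auto simp: subdiff_nonneg_def split: if_splits)
  have "(W ** V - transpose W ** U) \<bullet> (U - V) + 2 * lam * (norm (U - V))\<^sup>2
      = ((W ** V + lam *\<^sub>R (U - V)) - (transpose W ** U - lam *\<^sub>R (U - V))) \<bullet> (U - V)"
    unfolding power2_norm_eq_inner inner_diff_left[of _ _ "U - V"] inner_add_left inner_scaleR_left
    by simp
  \<comment> \<open>By criticality the two brackets are \<open>- G\<close> and
    \<open>- H\<close>.\<close>
  also have "\<dots> = (H - G) \<bullet> (U - V)"
    using eqs[THEN eq_neg_iff_add_eq_0[THEN iffD2]] by (simp only:) simp
  also have "\<dots> \<le> 0"
    using subdiff_nonneg_inner_diff[OF GH(1) \<open>0 \<le> V\<close>] subdiff_nonneg_inner_diff[OF GH(2) \<open>0 \<le> U\<close>]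
    by (simp add: inner_diff)
  finally have "2 * lam * (norm (U - V))\<^sup>2 \<le> (W ** (U - V)) \<bullet> (U - V)"
    using inner_residual_diff_ge[OF sym, of U V] by (simp add: W_def)
  also have "\<dots> \<le> norm W * (norm (U - V))\<^sup>2"
    by (rule inner_matrix_mult_le)
  finally have "2 * lam \<le> norm W"
    using \<open>U \<noteq> V\<close> by simp
  then show False
    using lam by (simp add: W_def mask_diff norm_minus_commute)
qed

text \<open>On the diagonal the penalty gradient vanishes and the first inclusion is already the one
  for (S).\<close>

lemma critical_point_A_diagonal: "critical_point_A E X lam U U \<Longrightarrow> critical_point_S E X U"
  by (simp add: critical_point_A_def critical_point_S_def)

theorem theorem2:
  fixes X :: "real ^ 'n ^ 'n"
    and E :: "('n \<times> 'n) set"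
    and U0 :: "real ^ 'r ^ 'n"
    and lam :: real
    and U V :: "nat \<Rightarrow> real ^ 'r ^ 'n"
    and Ustar Vstar :: "real ^ 'r ^ 'n"
  assumes "transpose X = X"
    and "sym E"
    and "0 \<le> U0"
    and "lam > 1/2 * (spectral_norm (mask E X)
                      + frobenius_norm (mask E (X - U0 ** transpose U0))
                      - min_eigenvalue (mask E X))"
    and "\<And>k. feasible_A (U k) (V k)"
    and "U 0 = U0" and "V 0 = U0"
    and "\<And>k. objective_A E X lam (U (Suc k)) (V (Suc k)) \<le> objective_A E X lam (U k) (V k)"
    and "(\<lambda>k. (U k, V k)) \<longlonglongrightarrow> (Ustar, Vstar)"
    and "critical_point_A E X lam Ustar Vstar"
  shows "Ustar = Vstar \<and> critical_point_S E X Ustar"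
proof -
  let ?S = "mask E (X - U0 ** transpose U0)"
  let ?T = "mask E (X - Ustar ** transpose Vstar)"
  have "min_eigenvalue (mask E X) \<le> spectral_norm (mask E X)"
    by (intro min_eigenvalue_le_spectral_norm) (simp add: transpose_mask assms(1,2))
  with assms(4) have lam: "norm ?S < 2 * lam"
    by (simp add: frobenius_norm_eq_norm)
  \<comment> \<open>This sign allows the penalty at the limit to be dropped below.\<close>
  then have "0 \<le> lam"
    using norm_ge_zero[of ?S] by linarith
  have "objective_A E X lam (U k) (V k) \<le> objective_A E X lam U0 U0" for k
    by (induction k) (use assms(6,7) order_trans[OF assms(8)] in auto)
  moreover have "(\<lambda>k. objective_A E X lam (U k) (V k)) \<longlonglongrightarrow> objective_A E X lam Ustar Vstar"
    using tendsto_fst[OF assms(9)] tendsto_snd[OF assms(9)] by (intro tendsto_objective_A) simp_all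
  ultimately have "objective_A E X lam Ustar Vstar \<le> objective_A E X lam U0 U0"
    by (meson LIMSEQ_le_const2)
  \<comment> \<open>Both initial factors are \<open>U0\<close>, so the right side carries no
    penalty.\<close>
  then have "(norm ?T)\<^sup>2 + lam * (norm (Ustar - Vstar))\<^sup>2 \<le> (norm ?S)\<^sup>2"
    by (simp add: objective_A_def frobenius_norm_eq_norm)
  moreover have "0 \<le> lam * (norm (Ustar - Vstar))\<^sup>2"
    using \<open>0 \<le> lam\<close> by simp
  ultimately have "(norm ?T)\<^sup>2 \<le> (norm ?S)\<^sup>2"
    by linarith
  then have "norm ?T < 2 * lam"
    using lam by (meson norm_ge_zero order_le_less_trans power2_le_imp_le)
  then have "Ustar = Vstar"
    by (rule critical_point_A_eq[OF assms(1,2,10)])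
  with assms(10) show ?thesis
    by (auto intro: critical_point_A_diagonal)
qed

end
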